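(* Let $G$ be a Polish non-locally-compact group admitting an invariant metric. Let $\mu$ be a Borel probability measure on $G$ whose carrier is a compact set $K_0\subseteq G$ (i.e. $\mu(G\setminus K_0)=0$). Then there exists a statistical structure $\{(G,\mathcal{B}(G),\mu_\theta):\theta\in\Theta\}$ in $G$ which has an objective consistent estimate of the parameter $\theta$ such that: (i) $\Theta\subseteq G$ and $\mathrm{card}(\Theta)=2^{\aleph_0}$; (ii) $\mu_\theta$ is the $\theta$-shift of the measure $\mu$ (i.e. $\mu_\theta(X)=\mu(\theta^{-1}X)$ for $X\in\mathcal{B}(G)$ and $\theta\in\Theta$).
   Context: $G$ is a Polish group: a separable group with a complete invariant metric $\rho$ (i.e. $\rho(fh_1g,fh_2g)=\rho(h_1,h_2)$ for all $f,g,h_1,h_2\in G$) for which the map $(x,y)\mapsto x^{-1}y$ from $G\times G$ onto $G$ is continuous. $\mathcal{B}(G)$ is the Borel $\sigma$-algebra of $G$. A Borel set $X\subseteq G$ is shy if there is a Borel probability measure $\nu$ on $G$ with $\nu(fXg)=0$ for all $f,g\in G$; a subset of a Borel shy set is also called shy. The complement of a shy set is prevalent. A Borel set is Haar ambivalent if it is neither shy nor prevalent. A statistical structure is a family of triplets $\{(G,\mathcal{B}(G),\mu_\theta):\theta\in\Theta\}$, where each $\mu_\theta$ is a Borel probability measure on $G$ and $\Theta$ is a non-empty set equipped with the $\sigma$-algebra $L(\Theta)$ generated by all singletons of $\Theta$. A $(\mathcal{B}(G),L(\Theta))$-measurable mapping $T:G\to\Theta$ is an objective consistent estimate of the parameter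 $\theta$ for this structure if (i) $\mu_\theta(T^{-1}(\theta))=1$ for each $\theta\in\Theta$, and (ii) $T^{-1}(\theta)$ is a Haar ambivalent set for each $\theta\in\Theta$. *)

theory Defs
  imports "HOL-Analysis.Analysis" "HOL-Probability.Probability" "HOL-Library.Equipollence"
begin

text \<open>
  The group is written additively, but \<^class>\<open>group_add\<close> does not assume commutativity:
  \<open>x + y\<close>, \<open>- x\<close>, \<open>0\<close> stand for \<open>x y\<close>, \<open>x\<^sup>-\<^sup>1\<close>, \<open>e\<close>. The complete metric of
  \<^class>\<open>polish_space\<close> is itself the two-sided invariant one; continuity of addition and
  negation amounts to continuity of \<open>(x, y) \<mapsto> x\<^sup>-\<^sup>1 y\<close>.
\<close>

class polish_group_add = polish_space + topological_group_add +
  assumes dist_invariant: "dist (f + x + g) (f + y + g) = dist x y"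

text \<open>
  Two-sided translates of Borel sets are Borel, so \<^const>\<open>emeasure\<close> below is never taken at
  a set outside its domain, where it would be \<open>0\<close> by convention.
\<close>

lemma two_sided_translate_borel:
  fixes X :: "'a::topological_group_add set"
  assumes "X \<in> sets borel"
  shows "(\<lambda>x. f + x + g) ` X \<in> sets borel"
proof -
  have eq: "(\<lambda>x. f + x + g) ` X = (\<lambda>y. - f + y + (- g)) -` X"
  proof (intro set_eqI iffI)
    fix y assume "y \<in> (\<lambda>y. - f + y + (- g)) -` X"
    moreover have "y = f + (- f + y + (- g)) + g" by (simp add: add.assoc)
    ultimately show "y \<in> (\<lambda>x. f + x + g) ` X" by blast
  qed (auto simp: add.assoc)
  have "continuous_on UNIV (\<lambda>y. - f + y + (- g))"
    unfolding continuous_on_def by (intro ballI tendsto_intros)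
  then have "(\<lambda>y. - f + y + (- g)) \<in> borel_measurable borel"
    by (rule borel_measurable_continuous_onI)
  from measurable_sets[OF this assms] show ?thesis by (simp add: eq)
qed

lemma left_translate_borel:
  fixes X :: "'a::topological_group_add set"
  assumes "X \<in> sets borel"
  shows "(\<lambda>x. f + x) ` X \<in> sets borel"
  using two_sided_translate_borel[OF assms, of f 0] by simp

definition borel_probability :: "'a::topological_space measure \<Rightarrow> bool" where
  "borel_probability \<nu> \<longleftrightarrow> sets \<nu> = sets borel \<and> prob_space \<nu>"

definition borel_shy :: "'a::polish_group_add set \<Rightarrow> bool" where
  "borel_shy B \<longleftrightarrow> B \<in> sets borel \<and>
     (\<exists>\<nu>. borel_probability \<nu> \<and> (\<forall>f g. emeasure \<nu> ((\<lambda>x. f + x + g) ` B) = 0))"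

definition shy :: "'a::polish_group_add set \<Rightarrow> bool" where
  "shy X \<longleftrightarrow> (\<exists>B. borel_shy B \<and> X \<subseteq> B)"

definition prevalent :: "'a::polish_group_add set \<Rightarrow> bool" where
  "prevalent X \<longleftrightarrow> shy (- X)"

definition Haar_ambivalent :: "'a::polish_group_add set \<Rightarrow> bool" where
  "Haar_ambivalent X \<longleftrightarrow> X \<in> sets borel \<and> \<not> shy X \<and> \<not> prevalent X"

definition statistical_structure ::
    "'p set \<Rightarrow> ('p \<Rightarrow> 'a::polish_group_add measure) \<Rightarrow> bool" where
  "statistical_structure \<Theta> M \<longleftrightarrow> \<Theta> \<noteq> {} \<and> (\<forall>\<theta>\<in>\<Theta>. borel_probability (M \<theta>))"

text \<open>Only the \<open>\<sigma>\<close>-algebra of this \<^typ>\<open>'p measure\<close> matters; its measure is zero.\<close>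

definition singleton_algebra :: "'p set \<Rightarrow> 'p measure" where
  "singleton_algebra \<Theta> = sigma \<Theta> {{\<theta>} |\<theta>. \<theta> \<in> \<Theta>}"

definition objective_consistent_estimate ::
    "'p set \<Rightarrow> ('p \<Rightarrow> 'a::polish_group_add measure) \<Rightarrow> ('a \<Rightarrow> 'p) \<Rightarrow> bool" where
  "objective_consistent_estimate \<Theta> M T \<longleftrightarrow>
     T \<in> borel \<rightarrow>\<^sub>M singleton_algebra \<Theta> \<and>
     (\<forall>\<theta>\<in>\<Theta>. emeasure (M \<theta>) (T -` {\<theta>}) = 1) \<and>
     (\<forall>\<theta>\<in>\<Theta>. Haar_ambivalent (T -` {\<theta>}))"

end

theory Submission
  imports Defs
begin

text \<open>
  The idea, which goes back to Solecki's work on Haar null sets, is to find continuum many pairwise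
  disjoint closed sets, indexed by the subsets of \<open>\<nat>\<close>, each of which contains a left translate of
  every compact set, and whose union is closed as well (\<open>disjoint_closed_sets_absorbing_compact\<close>).
  A set that contains a translate of every compact set is not shy, because every Borel probability
  measure on a Polish space charges some compact set (\<open>not_shy_if_absorbs_compact\<close>). The sets are
  disjoint, so the complement of each of them contains another one, and none of them is prevalent.
  If \<open>\<theta>\<^sub>p + K\<^sub>0\<close> is the translate of the carrier \<open>K\<^sub>0\<close> that lies in the set with index \<open>p\<close>, then the
  estimate \<open>T\<close> that takes the value \<open>\<theta>\<^sub>p\<close> on this set, with all leftover points sent to one
  fixed parameter, has the required properties.

  For the construction of the sets, completeness and the failure of local compactness imply that
  no ball around \<open>0\<close> is totally bounded. Hence for each radius \<open>\<epsilon>\<close> there is \<open>\<delta>\<close> such that any finite set can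
  be \<open>\<delta>\<close>-avoided by an element of the \<open>\<epsilon>\<close>-ball. Fix a dense sequence \<open>q\<close>. At each level \<open>m\<close>,
  this gives small elements \<open>g m i\<close> such that the translates \<open>g m i + {q 0, \<dots>, q i}\<close>, for
  \<open>i \<in> \<nat>\<close>, are uniformly apart, and all later levels can be taken very small compared with this
  distance. A sequence \<open>f : \<nat> \<rightarrow> \<nat>\<close> determines the infinite sum
  \<open>h = g 0 (f 0) + g 1 (f 1) + \<dots>\<close>. If \<open>f\<close> grows so fast that a given compact set \<open>K\<close> is well
  approximated by \<open>{q 0, \<dots>, q (f m)}\<close> for each \<open>m\<close>, then \<open>h + K\<close> consists of points from which \<open>f\<close>
  can be read off, one level after the other. The growth condition leaves the parity of
  \<open>f m\<close> free, and the parities encode the index \<open>p\<close>.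
\<close>

section \<open>Invariant metrics and sets that are not shy\<close>

lemma dist_add_left: "dist (h + x) (h + y) = dist x (y :: 'a::polish_group_add)"
  using dist_invariant[of h x 0 y] by simp

lemma dist_add_right: "dist (x + h) (y + h) = dist x (y :: 'a::polish_group_add)"
  using dist_invariant[of 0 x h y] by simp

lemma shy_mono: "shy Y \<Longrightarrow> X \<subseteq> Y \<Longrightarrow> shy X"
  unfolding shy_def by blast

text \<open>
  A Borel probability measure on a Polish space is tight, so it gives positive measure to some
  compact set; this set would be null if one of its translates lay in a shy set.
\<close>

lemma not_shy_if_absorbs_compact:
  fixes X :: "'a::polish_group_add set"
  assumes absorbs: "\<And>K. compact K \<Longrightarrow> \<exists>h. (+) h ` K \<subseteq> X"
  shows "\<not> shy X"
proof
  assume "shy X"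
  then obtain B \<nu> where XB: "X \<subseteq> B" and B: "B \<in> sets borel" and \<nu>: "borel_probability \<nu>"
    and null: "\<And>f g. emeasure \<nu> ((\<lambda>x. f + x + g) ` B) = 0"
    unfolding shy_def borel_shy_def by blast
  from \<nu> have sets: "sets \<nu> = sets borel" and prob: "prob_space \<nu>"
    by (auto simp: borel_probability_def)
  have space: "space \<nu> = UNIV"
    using sets_eq_imp_space_eq[OF sets] by simp
  have total: "emeasure \<nu> UNIV = 1"
    using prob_space.emeasure_space_1[OF prob] space by simp
  have "emeasure \<nu> UNIV = (SUP K\<in>{K. K \<subseteq> UNIV \<and> compact K}. emeasure \<nu> K)"
    by (rule inner_regular) (use sets space total in auto)
  with total have "0 < (SUP K\<in>{K. K \<subseteq> UNIV \<and> compact K}. emeasure \<nu> K)" by simp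
  then obtain K where K: "compact K" and pos: "0 < emeasure \<nu> K"
    unfolding less_SUP_iff by auto
  from absorbs[OF K] XB obtain h where h: "(+) h ` K \<subseteq> B" by blast
  have "K \<subseteq> (\<lambda>x. - h + x + 0) ` B"
  proof
    fix x assume "x \<in> K"
    with h have "h + x \<in> B" by blast
    then show "x \<in> (\<lambda>x. - h + x + 0) ` B" by (force simp: add.assoc[symmetric])
  qed
  then have "emeasure \<nu> K \<le> emeasure \<nu> ((\<lambda>x. - h + x + 0) ` B)"
    by (rule emeasure_mono) (simp only: sets two_sided_translate_borel[OF B])
  with pos null[of "- h" 0] show False by simp
qed

section \<open>Balls are not totally bounded\<close>

text \<open>
  In a complete metric, total boundedness of a ball around \<open>0\<close> would make a smaller closed ball
  compact, and translating it would give compact neighbourhoods of all points. It matters that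
  \<open>\<delta>\<close> depends on \<open>\<epsilon>\<close> alone and not on the finite set to be avoided.
\<close>

lemma small_elements_avoid_finite_sets:
  fixes \<epsilon> :: real
  assumes nlc: "\<not> locally_compact_space (euclidean :: 'a::polish_group_add topology)"
    and "0 < \<epsilon>"
  obtains \<delta> where "0 < \<delta>" "\<delta> \<le> \<epsilon>"
    "\<And>L :: 'a set. finite L \<Longrightarrow> \<exists>g. dist 0 g \<le> \<epsilon> \<and> (\<forall>l\<in>L. \<delta> \<le> dist g l)"
proof -
  have "\<exists>\<delta>>0. \<forall>L :: 'a set. finite L \<longrightarrow> (\<exists>g. dist 0 g \<le> \<epsilon> \<and> (\<forall>l\<in>L. \<delta> \<le> dist g l))"
  proof (rule ccontr)
    assume contra: "\<not> ?thesis"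
    have "\<exists>L :: 'a set. finite L \<and> cball 0 \<epsilon> \<subseteq> (\<Union>l\<in>L. ball l \<delta>)" if "0 < \<delta>" for \<delta>
    proof -
      from contra that obtain L :: "'a set" where "finite L"
        and "\<And>g. dist 0 g \<le> \<epsilon> \<Longrightarrow> \<exists>l\<in>L. dist g l < \<delta>"
        by (metis not_le)
      then show ?thesis by (intro exI[of _ L]) (auto simp: dist_commute)
    qed
    then have compact0: "compact (cball (0::'a) \<epsilon>)"
      unfolding compact_eq_totally_bounded by (simp add: complete_eq_closed)
    have "locally_compact_space (euclidean :: 'a topology)"
      unfolding locally_compact_space_def
    proof (intro ballI)
      fix x :: 'a
      have "continuous_on (cball 0 \<epsilon>) ((+) x)"
        unfolding continuous_on_def by (intro ballI tendsto_intros)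
      then have "compact ((+) x ` cball 0 \<epsilon>)" by (rule compact_continuous_image) (rule compact0)
      moreover have "ball x \<epsilon> \<subseteq> (+) x ` cball 0 \<epsilon>"
      proof
        fix y assume "y \<in> ball x \<epsilon>"
        moreover have "dist 0 (- x + y) = dist x y"
          using dist_add_left[of x 0 "- x + y"] by (simp add: add.assoc[symmetric])
        ultimately have "- x + y \<in> cball 0 \<epsilon>" by simp
        moreover have "y = x + (- x + y)" by (simp add: add.assoc[symmetric])
        ultimately show "y \<in> (+) x ` cball 0 \<epsilon>" by blast
      qed
      ultimately show "\<exists>U K. openin euclidean U \<and> compactin euclidean K \<and> x \<in> U \<and> U \<subseteq> K"
        using \<open>0 < \<epsilon>\<close> by (intro exI[of _ "ball x \<epsilon>"] exI[of _ "(+) x ` cball 0 \<epsilon>"]) auto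
    qed
    with nlc show False by simp
  qed
  then obtain \<delta> where "0 < \<delta>" and
    \<delta>: "\<And>L :: 'a set. finite L \<Longrightarrow> \<exists>g. dist 0 g \<le> \<epsilon> \<and> (\<forall>l\<in>L. \<delta> \<le> dist g l)" by blast
  show thesis
  proof (rule that[of "min \<delta> \<epsilon>"])
    show "\<exists>g. dist 0 g \<le> \<epsilon> \<and> (\<forall>l\<in>L. min \<delta> \<epsilon> \<le> dist g l)" if "finite L" for L :: "'a set"
      using \<delta>[OF that] by (meson min.coboundedI1)
  qed (use \<open>0 < \<delta>\<close> \<open>0 < \<epsilon>\<close> in auto)
qed

section \<open>Infinite sums of small translations\<close>

text \<open>
  The translations of level \<open>m\<close> have size at most \<open>e m\<close>, and they move the finite sets
  \<open>{q 0, \<dots>, q i}\<close> apart by \<open>16 * e (Suc m)\<close>, the bound \<open>\<delta>\<close> that belongs to \<open>\<epsilon> = e m\<close>. The factor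
  16 leaves room for two errors, each made for both of two points: the total size of all later
  translations, at most \<open>2 * e (Suc m)\<close>, and the approximation of a compact set, also within
  \<open>2 * e (Suc m)\<close>.
\<close>

locale separating_translations =
  fixes q :: "nat \<Rightarrow> 'a::polish_group_add" and g :: "nat \<Rightarrow> nat \<Rightarrow> 'a" and e :: "nat \<Rightarrow> real"
  assumes dense: "0 < r \<Longrightarrow> \<exists>n. dist (q n) y < r"
    and e_pos: "0 < e m"
    and e_decay: "16 * e (Suc m) \<le> e m"
    and g_small: "dist 0 (g m i) \<le> e m"
    and g_separated: "i \<noteq> j \<Longrightarrow> a \<le> i \<Longrightarrow> b \<le> j \<Longrightarrow>
      16 * e (Suc m) \<le> dist (g m i + q a) (g m j + q b)"

text \<open>
  Since the metric is invariant, \<open>g m i + q a\<close> is at distance at least \<open>\<delta>\<close> from \<open>g m j + q b\<close> as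
  soon as \<open>g m i\<close> is at distance at least \<open>\<delta>\<close> from \<open>g m j + q b - q a\<close>. For \<open>j < i\<close> these are
  finitely many points, so \<open>g m i\<close> can be chosen by recursion on \<open>i\<close>.
\<close>

lemma separating_translations_exist:
  assumes nlc: "\<not> locally_compact_space (euclidean :: 'a::polish_group_add topology)"
  obtains q :: "nat \<Rightarrow> 'a::polish_group_add" and g e where "separating_translations q g e"
proof -
  obtain D :: "'a set" where D: "countable D" "\<And>X. open X \<Longrightarrow> X \<noteq> {} \<Longrightarrow> \<exists>d\<in>D. d \<in> X"
    using countable_dense_setE by blast
  define q where "q = from_nat_into D"
  have "D \<noteq> {}" using D(2)[of UNIV] by auto
  have dense: "\<exists>n. dist (q n) y < r" if "0 < r" for r y
  proof -
    from D(2)[of "ball y r"] that obtain d where "d \<in> D" "dist y d < r" by auto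
    then show ?thesis using D(1) unfolding q_def by (metis dist_commute from_nat_into_surj)
  qed
  define avoids where "avoids \<epsilon> \<delta> \<longleftrightarrow>
    (\<forall>L :: 'a set. finite L \<longrightarrow> (\<exists>g. dist 0 g \<le> \<epsilon> \<and> (\<forall>l\<in>L. \<delta> \<le> dist g l)))" for \<epsilon> \<delta> :: real
  have "\<exists>e. \<forall>m::nat. 0 < e m \<and> (16 * e (Suc m) \<le> e m \<and> avoids (e m) (16 * e (Suc m)))"
  proof (rule dependent_nat_choice)
    fix \<epsilon> :: real
    assume "0 < \<epsilon>"
    from small_elements_avoid_finite_sets[OF nlc this] obtain \<delta>
      where "0 < \<delta>" "\<delta> \<le> \<epsilon>" "avoids \<epsilon> \<delta>"
      unfolding avoids_def by blast
    then show "\<exists>\<delta>>0. 16 * \<delta> \<le> \<epsilon> \<and> avoids \<epsilon> (16 * \<delta>)"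
      by (intro exI[of _ "\<delta> / 16"]) auto
  qed (auto intro: exI[of _ 1])
  then obtain e where e: "\<And>m. 0 < e m" "\<And>m. 16 * e (Suc m) \<le> e m"
    "\<And>m. avoids (e m) (16 * e (Suc m))" by blast
  have "\<exists>c. \<forall>i. dist 0 (c i) \<le> e m \<and>
      (\<forall>j<i. \<forall>a\<le>i. \<forall>b\<le>j. 16 * e (Suc m) \<le> dist (c i) (c j + q b - q a))" for m
  proof (rule dependent_wellorder_choice)
    fix i :: nat and c :: "nat \<Rightarrow> 'a"
    define L where "L = (\<lambda>(j, b, a). c j + q b - q a) ` ({..<i} \<times> {..i} \<times> {..i})"
    have "finite L" by (simp add: L_def)
    with e(3)[of m] obtain x where x: "dist 0 x \<le> e m" "\<And>l. l \<in> L \<Longrightarrow> 16 * e (Suc m) \<le> dist x l"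
      unfolding avoids_def by blast
    have "c j + q b - q a \<in> L" if "j < i" "a \<le> i" "b \<le> j" for j a b
      unfolding L_def using that by (intro image_eqI[of _ _ "(j, b, a)"]) auto
    with x show "\<exists>x. dist 0 x \<le> e m \<and>
        (\<forall>j<i. \<forall>a\<le>i. \<forall>b\<le>j. 16 * e (Suc m) \<le> dist x (c j + q b - q a))" by blast
  qed auto
  then obtain g where g: "\<And>m i. dist 0 (g m i) \<le> e m"
    "\<And>m i j a b. j < i \<Longrightarrow> a \<le> i \<Longrightarrow> b \<le> j \<Longrightarrow>
      16 * e (Suc m) \<le> dist (g m i) (g m j + q b - q a)"
    by metis
  have less: "16 * e (Suc m) \<le> dist (g m i + q a) (g m j + q b)"
    if "j < i" "a \<le> i" "b \<le> j" for m i j a b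
    using g(2)[OF that, of m] dist_add_right[of "g m i" "q a" "g m j + q b - q a"]
    by simp
  have "separating_translations q g e"
  proof
    show "16 * e (Suc m) \<le> dist (g m i + q a) (g m j + q b)"
      if "i \<noteq> j" "a \<le> i" "b \<le> j" for m i j a b
      using that less[of j i a b m] less[of i j b a m] by (cases "j < i") (auto simp: dist_commute)
  qed (use dense e g in auto)
  then show thesis by (rule that)
qed

context separating_translations
begin

primrec partial_translation :: "(nat \<Rightarrow> nat) \<Rightarrow> nat \<Rightarrow> 'a" where
  "partial_translation f 0 = 0"
| "partial_translation f (Suc n) = partial_translation f n + g n (f n)"

lemma partial_translation_cong:
  "(\<And>k. k < n \<Longrightarrow> f k = f' k) \<Longrightarrow> partial_translation f n = partial_translation f' n"
  by (induction n) auto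

lemma e_antimono: "m \<le> n \<Longrightarrow> e n \<le> e m"
proof (rule lift_Suc_antimono_le)
  show "e (Suc n) \<le> e n" for n using e_decay[of n] e_pos[of "Suc n"] by linarith
qed

lemma e_bound: "e n \<le> e 0 * (1 / 16) ^ n"
proof (induction n)
  case (Suc n)
  then show ?case using e_decay[of n] by simp
qed simp

lemma e_tendsto_0: "e \<longlonglongrightarrow> 0"
proof (rule tendsto_sandwich[OF _ _ tendsto_const])
  show "(\<lambda>n. e 0 * (1 / 16) ^ n) \<longlonglongrightarrow> 0"
    by (intro tendsto_mult_right_zero LIMSEQ_power_zero) simp
qed (use e_bound e_pos in \<open>auto intro: always_eventually less_imp_le\<close>)

text \<open>
  The subtracted term \<open>2 * e (n + k)\<close> makes the induction on \<open>k\<close> work: the next step has size at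
  most \<open>e (n + k)\<close>, which is at most \<open>2 * e (n + k) - 2 * e (n + k + 1)\<close>.
\<close>

lemma partial_translation_increment:
  "dist (partial_translation f n) (partial_translation f (n + k)) \<le> 2 * e n - 2 * e (n + k)"
proof (induction k)
  case (Suc k)
  have "dist (partial_translation f (n + k)) (partial_translation f (n + Suc k)) \<le> e (n + k)"
    using g_small[of "n + k" "f (n + k)"]
      dist_add_left[of "partial_translation f (n + k)" 0 "g (n + k) (f (n + k))"] by simp
  moreover have "e (n + k) \<le> 2 * e (n + k) - 2 * e (n + Suc k)"
    using e_decay[of "n + k"] e_pos[of "Suc (n + k)"] by simp
  ultimately show ?case
    using Suc dist_triangle[of "partial_translation f n" "partial_translation f (n + Suc k)"
      "partial_translation f (n + k)"] by linarith
qed simp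

lemma total_translation_exists:
  obtains h where "\<And>n. dist h (partial_translation f n) \<le> 2 * e n"
proof -
  have near: "dist (partial_translation f n) (partial_translation f m) \<le> 2 * e n" if "n \<le> m" for n m
    using partial_translation_increment[of f n "m - n"] e_pos[of m] that by simp
  have "Cauchy (partial_translation f)"
    unfolding Cauchy_altdef
  proof (intro allI impI)
    fix r :: real assume "0 < r"
    then obtain N where N: "e N < r / 2"
      using order_tendstoD(2)[OF e_tendsto_0, of "r / 2"] by (auto simp: eventually_sequentially)
    have "dist (partial_translation f m) (partial_translation f n) < r" if "N \<le> m" "m < n" for m n
      using near[of m n] that e_antimono[of N m] N by linarith
    then show "\<exists>N. \<forall>m\<ge>N. \<forall>n>m. dist (partial_translation f m) (partial_translation f n) < r"
      by blast
  qed
  then obtain h where h: "partial_translation f \<longlonglongrightarrow> h"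
    unfolding Cauchy_convergent_iff convergent_def by blast
  have "dist h (partial_translation f n) \<le> 2 * e n" for n
  proof (rule tendsto_upperbound)
    show "(\<lambda>m. dist (partial_translation f m) (partial_translation f n))
        \<longlonglongrightarrow> dist h (partial_translation f n)"
      using h by (intro tendsto_intros)
    show "\<forall>\<^sub>F m in sequentially. dist (partial_translation f m) (partial_translation f n) \<le> 2 * e n"
      using near[of n] by (auto simp: eventually_sequentially dist_commute)
  qed simp
  then show thesis by (rule that)
qed

section \<open>Branches and their parities\<close>

text \<open>
  The points of the branch of \<open>f\<close> are those that look, at each level \<open>m\<close>, like points of the
  translate of a compact set that is well approximated by \<open>{q 0, \<dots>, q (f m)}\<close>.
\<close>

definition branch :: "(nat \<Rightarrow> nat) \<Rightarrow> 'a set" where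
  "branch f = {x. \<forall>m. \<exists>a\<le>f m. dist x (partial_translation f (Suc m) + q a) \<le> 4 * e (Suc m)}"

text \<open>
  The sequence \<open>f\<close> can be read off from each point of its branch: once the first \<open>k\<close> entries are
  known, translations with different next entries put the finite sets \<open>16 * e (Suc k)\<close> apart,
  while the points of the branch are within \<open>4 * e (Suc k)\<close> of these sets. The slack of
  \<open>8 * e (Suc k)\<close> is what makes unions of branches closed.
\<close>

lemma near_branches_agree:
  assumes x: "x \<in> branch f" and y: "y \<in> branch f'" and xy: "dist x y < 8 * e (Suc m)"
  shows "k \<le> m \<Longrightarrow> f k = f' k"
proof (induction k rule: less_induct)
  case (less k)
  let ?h = "partial_translation f k"
  have same: "partial_translation f' k = ?h"
    using less by (intro partial_translation_cong) auto
  from x obtain a where a: "a \<le> f k" "dist x (?h + g k (f k) + q a) \<le> 4 * e (Suc k)"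
    unfolding branch_def by auto
  from y obtain b where b: "b \<le> f' k" "dist y (?h + g k (f' k) + q b) \<le> 4 * e (Suc k)"
    unfolding branch_def by (auto simp: same[symmetric])
  show ?case
  proof (rule ccontr)
    assume "f k \<noteq> f' k"
    then have "16 * e (Suc k) \<le> dist (g k (f k) + q a) (g k (f' k) + q b)"
      using a b by (intro g_separated) auto
    also have "\<dots> = dist (?h + g k (f k) + q a) (?h + g k (f' k) + q b)"
      by (simp add: dist_add_left add.assoc)
    also have "\<dots> \<le> dist x (?h + g k (f k) + q a) + dist x y + dist y (?h + g k (f' k) + q b)"
      using dist_triangle2[of "?h + g k (f k) + q a" y x]
        dist_triangle[of "?h + g k (f k) + q a" "?h + g k (f' k) + q b" y]
      by (simp add: dist_commute)
    also have "\<dots> < 16 * e (Suc k)"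
      using a b xy e_antimono[of "Suc k" "Suc m"] less.prems by simp
    finally show False by simp
  qed
qed

text \<open>
  A limit of points of branches is approximated by points whose sequences agree on longer and
  longer initial segments, so the diagonal sequence describes a branch that contains the limit.
\<close>

lemma closed_Union_branch: "closed (\<Union>f\<in>{f. \<forall>m. f m \<in> A m}. branch f)" (is "closed ?Y")
proof -
  have "x \<in> ?Y" if "x \<in> closure ?Y" for x
  proof -
    have "\<exists>y f. y \<in> branch f \<and> (\<forall>k. f k \<in> A k) \<and> dist y x < e (Suc m)" for m
      using that e_pos[of "Suc m"] unfolding closure_approachable by blast
    then obtain y f where y: "\<And>m. y m \<in> branch (f m)" and A: "\<And>m k. f m k \<in> A k"
      and yx: "\<And>m. dist (y m) x < e (Suc m)" by metis
    define d where "d k = f k k" for k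
    have d: "f n k = d k" if "k \<le> n" for n k
      unfolding d_def
    proof (rule near_branches_agree[OF y y _ order_refl])
      show "dist (y n) (y k) < 8 * e (Suc k)"
        using yx[of n] yx[of k] e_antimono[of "Suc k" "Suc n"] that e_pos[of "Suc k"]
          dist_triangle2[of "y n" "y k" x] by linarith
    qed
    have yx_lim: "(\<lambda>n. y (n + m)) \<longlonglongrightarrow> x" for m
    proof (rule LIMSEQ_ignore_initial_segment, rule tendsto_dist_iff[THEN iffD2],
        rule tendsto_sandwich[OF _ _ tendsto_const])
      show "(\<lambda>n. e (Suc n)) \<longlonglongrightarrow> 0" using e_tendsto_0 by (rule LIMSEQ_Suc)
    qed (use yx in \<open>simp_all add: less_imp_le\<close>)
    have "x \<in> branch d"
      unfolding branch_def mem_Collect_eq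
    proof
      fix m
      let ?N = "\<Union>a\<in>{..d m}. cball (partial_translation d (Suc m) + q a) (4 * e (Suc m))"
      have "y (n + m) \<in> ?N" for n
      proof -
        have "partial_translation (f (n + m)) (Suc m) = partial_translation d (Suc m)"
          using d by (intro partial_translation_cong) auto
        moreover have "f (n + m) m = d m" using d by simp
        moreover from y[of "n + m"] obtain a where "a \<le> f (n + m) m"
          "dist (y (n + m)) (partial_translation (f (n + m)) (Suc m) + q a) \<le> 4 * e (Suc m)"
          unfolding branch_def by blast
        ultimately show ?thesis
          by (intro UN_I[of a]) (simp_all only: atMost_iff mem_cball dist_commute)
      qed
      moreover have "closed ?N" by (intro closed_UN) auto
      ultimately have "x \<in> ?N" using yx_lim closed_sequentially[of ?N "\<lambda>n. y (n + m)" x] by simp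
      then show "\<exists>a\<le>d m. dist x (partial_translation d (Suc m) + q a) \<le> 4 * e (Suc m)"
        unfolding UN_iff mem_cball atMost_iff Bex_def dist_commute[of x] .
    qed
    moreover have "d k \<in> A k" for k unfolding d_def by (rule A)
    ultimately show ?thesis by blast
  qed
  then show ?thesis using closure_subset_eq by blast
qed

lemma compact_near_initial_segment:
  assumes "compact K" "0 < r"
  obtains n where "\<And>x. x \<in> K \<Longrightarrow> \<exists>a\<le>n. dist x (q a) < r"
proof -
  have "K \<subseteq> (\<Union>n. ball (q n) r)" using dense[OF \<open>0 < r\<close>] by fastforce
  with \<open>compact K\<close> obtain I where "finite I" and I: "K \<subseteq> (\<Union>n\<in>I. ball (q n) r)"
    using compactE_image[of K UNIV "\<lambda>n. ball (q n) r"] by (metis open_ball)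
  show thesis
  proof (rule that[of "Max I"])
    show "\<exists>a\<le>Max I. dist x (q a) < r" if "x \<in> K" for x
    proof -
      from I that obtain a where "a \<in> I" "dist (q a) x < r" by auto
      with \<open>finite I\<close> show ?thesis by (auto simp: dist_commute intro!: exI[of _ a])
    qed
  qed
qed

definition parity_piece :: "nat set \<Rightarrow> 'a set" where
  "parity_piece p = (\<Union>f\<in>{f. \<forall>m. f m \<in> {n. odd n \<longleftrightarrow> m \<in> p}}. branch f)"

lemma closed_parity_piece: "closed (parity_piece p)"
  unfolding parity_piece_def by (rule closed_Union_branch)

lemma closed_Union_parity_piece: "closed (\<Union>p. parity_piece p)"
proof -
  have "(\<Union>p. parity_piece p) = (\<Union>f\<in>{f. \<forall>m. f m \<in> UNIV}. branch f)"
  proof (intro equalityI subsetI)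
    fix x assume "x \<in> (\<Union>f\<in>{f. \<forall>m. f m \<in> UNIV}. branch f)"
    then obtain f where "x \<in> branch f" by blast
    then have "x \<in> parity_piece {m. odd (f m)}" unfolding parity_piece_def by auto
    then show "x \<in> (\<Union>p. parity_piece p)" by blast
  qed (auto simp: parity_piece_def)
  then show ?thesis using closed_Union_branch[of "\<lambda>_. UNIV"] by simp
qed

lemma parity_piece_inject:
  assumes "x \<in> parity_piece p" "x \<in> parity_piece p'"
  shows "p = p'"
proof -
  from assms obtain f f' where f: "x \<in> branch f" "\<And>m. odd (f m) \<longleftrightarrow> m \<in> p"
    and f': "x \<in> branch f'" "\<And>m. odd (f' m) \<longleftrightarrow> m \<in> p'"
    unfolding parity_piece_def by auto
  have "f m = f' m" for m
    by (rule near_branches_agree[OF f(1) f'(1) _ order_refl]) (simp add: e_pos)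
  with f(2) f'(2) have "m \<in> p \<longleftrightarrow> m \<in> p'" for m by metis
  then show ?thesis by (rule set_eqI)
qed

lemma parity_piece_absorbs_compact:
  assumes "compact K"
  shows "\<exists>h. (+) h ` K \<subseteq> parity_piece p"
proof -
  have "\<exists>n. \<forall>x\<in>K. \<exists>a\<le>n. dist x (q a) < 2 * e (Suc m)" for m
  proof -
    have "0 < 2 * e (Suc m)" using e_pos[of "Suc m"] by simp
    from compact_near_initial_segment[OF assms this] obtain n
      where "\<And>x. x \<in> K \<Longrightarrow> \<exists>a\<le>n. dist x (q a) < 2 * e (Suc m)" by metis
    then show ?thesis by blast
  qed
  then obtain N where N: "\<And>m x. x \<in> K \<Longrightarrow> \<exists>a\<le>N m. dist x (q a) < 2 * e (Suc m)" by metis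
  \<comment> \<open>Doubling keeps \<open>f m\<close> above \<open>N m\<close> and frees its last binary digit for the index \<open>p\<close>.\<close>
  define f where "f m = 2 * N m + of_bool (m \<in> p)" for m
  obtain h where h: "\<And>n. dist h (partial_translation f n) \<le> 2 * e n"
    by (rule total_translation_exists[of f], rule that) blast
  have "h + x \<in> branch f" if "x \<in> K" for x
    unfolding branch_def mem_Collect_eq
  proof
    fix m
    let ?s = "partial_translation f (Suc m)"
    from N[OF that] obtain a where a: "a \<le> N m" "dist x (q a) < 2 * e (Suc m)" by blast
    have "dist (h + x) (?s + q a) \<le> dist (h + x) (h + q a) + dist (h + q a) (?s + q a)"
      by (rule dist_triangle)
    also have "\<dots> = dist x (q a) + dist h ?s" by (simp only: dist_add_left dist_add_right)
    also have "\<dots> \<le> 4 * e (Suc m)" using a(2) h[of "Suc m"] by linarith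
    finally show "\<exists>a\<le>f m. dist (h + x) (?s + q a) \<le> 4 * e (Suc m)"
      using a(1) by (intro exI[of _ a]) (simp add: f_def)
  qed
  moreover have "odd (f m) \<longleftrightarrow> m \<in> p" for m by (simp add: f_def)
  ultimately have "(+) h ` K \<subseteq> parity_piece p" unfolding parity_piece_def by blast
  then show ?thesis ..
qed

end

lemma disjoint_closed_sets_absorbing_compact:
  assumes "\<not> locally_compact_space (euclidean :: 'a::polish_group_add topology)"
  shows "\<exists>Y :: nat set \<Rightarrow> 'a::polish_group_add set.
    (\<forall>p. closed (Y p)) \<and> closed (\<Union>p. Y p) \<and>
    (\<forall>p p'. p \<noteq> p' \<longrightarrow> Y p \<inter> Y p' = {}) \<and>
    (\<forall>p K. compact K \<longrightarrow> (\<exists>h. (+) h ` K \<subseteq> Y p))"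
proof -
  obtain q :: "nat \<Rightarrow> 'a" and g e where "separating_translations q g e"
    using separating_translations_exist[OF assms] .
  then interpret separating_translations q g e .
  have "\<forall>p p'. p \<noteq> p' \<longrightarrow> parity_piece p \<inter> parity_piece p' = {}"
    using parity_piece_inject by blast
  then show ?thesis
    using closed_parity_piece closed_Union_parity_piece parity_piece_absorbs_compact
    by (intro exI[of _ parity_piece] conjI allI impI) simp_all
qed

section \<open>The statistical structure and its estimate\<close>

lemma measurable_left_shift:
  fixes \<mu> :: "'a::topological_group_add measure"
  assumes "sets \<mu> = sets borel"
  shows "(+) \<theta> \<in> \<mu> \<rightarrow>\<^sub>M borel"
proof -
  have "continuous_on UNIV ((+) \<theta>)"
    unfolding continuous_on_def by (intro ballI tendsto_intros)
  then have "(+) \<theta> \<in> borel \<rightarrow>\<^sub>M borel" by (rule borel_measurable_continuous_onI)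
  then show ?thesis by (simp only: measurable_cong_sets[OF assms refl])
qed

lemma emeasure_left_shift:
  fixes \<mu> :: "'a::topological_group_add measure"
  assumes "sets \<mu> = sets borel" "X \<in> sets borel"
  shows "emeasure (distr \<mu> borel ((+) \<theta>)) X = emeasure \<mu> ((\<lambda>x. - \<theta> + x) ` X)"
proof -
  have "(+) \<theta> -` X \<inter> space \<mu> = (\<lambda>x. - \<theta> + x) ` X"
    using sets_eq_imp_space_eq[OF assms(1)] by (force simp: add.assoc[symmetric])
  then show ?thesis using measurable_left_shift[OF assms(1)] assms(2) by (simp add: emeasure_distr)
qed

lemma borel_probability_left_shift:
  fixes \<mu> :: "'a::topological_group_add measure"
  assumes "borel_probability \<mu>"
  shows "borel_probability (distr \<mu> borel ((+) \<theta>))"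
proof -
  from assms have sets: "sets \<mu> = sets borel" and prob: "prob_space \<mu>"
    by (auto simp: borel_probability_def)
  show ?thesis
    unfolding borel_probability_def
    using prob_space.prob_space_distr[OF prob measurable_left_shift[OF sets]] by simp
qed

theorem theorem6p20:
  fixes \<mu> :: "'a::polish_group_add measure" and K\<^sub>0 :: "'a set"
  assumes "\<not> locally_compact_space (euclidean :: 'a topology)"
    and "borel_probability \<mu>"
    and "compact K\<^sub>0"
    and "emeasure \<mu> (UNIV - K\<^sub>0) = 0"
  shows "\<exists>(\<Theta> :: 'a set) (M :: 'a \<Rightarrow> 'a measure).
           statistical_structure \<Theta> M \<and>
           (\<exists>T. objective_consistent_estimate \<Theta> M T) \<and>
           \<Theta> \<approx> (UNIV :: nat set set) \<and>
           (\<forall>\<theta>\<in>\<Theta>. \<forall>X\<in>sets borel. emeasure (M \<theta>) X = emeasure \<mu> ((\<lambda>x. - \<theta> + x) ` X))"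
proof -
  obtain Y :: "nat set \<Rightarrow> 'a set" where Y:
    "(\<forall>p. closed (Y p)) \<and> closed (\<Union>p. Y p) \<and> (\<forall>p p'. p \<noteq> p' \<longrightarrow> Y p \<inter> Y p' = {}) \<and>
      (\<forall>p K. compact K \<longrightarrow> (\<exists>h. (+) h ` K \<subseteq> Y p))"
    using disjoint_closed_sets_absorbing_compact[OF assms(1)] ..
  then have closed: "\<And>p. closed (Y p)" "closed (\<Union>p. Y p)" by simp_all
  from Y have absorbs: "\<exists>h. (+) h ` K \<subseteq> Y p" if "compact K" for p K using that by simp
  from Y have inject: "p = p'" if "x \<in> Y p" "x \<in> Y p'" for p p' x using that by blast
  from absorbs[OF assms(3)] obtain \<theta> where \<theta>: "\<And>p. (+) (\<theta> p) ` K\<^sub>0 \<subseteq> Y p" by metis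
  from assms(2) have sets: "sets \<mu> = sets borel" and prob: "prob_space \<mu>"
    by (auto simp: borel_probability_def)
  have space: "space \<mu> = UNIV" using sets_eq_imp_space_eq[OF sets] by simp
  have total: "emeasure \<mu> UNIV = 1" using prob_space.emeasure_space_1[OF prob] space by simp
  have K0: "K\<^sub>0 \<in> sets borel" using assms(3) by (simp add: borel_compact)
  have \<mu>K0: "emeasure \<mu> K\<^sub>0 = 1"
    using emeasure_Un_null_set[of K\<^sub>0 \<mu> "UNIV - K\<^sub>0"] assms(4) K0 sets total
    by (simp add: null_sets_def Diff_eq)
  then have "K\<^sub>0 \<noteq> {}" by auto
  have inj: "inj \<theta>"
  proof (rule injI)
    fix p p' assume eq: "\<theta> p = \<theta> p'"
    from \<open>K\<^sub>0 \<noteq> {}\<close> obtain x where "x \<in> K\<^sub>0" by blast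
    with \<theta>[of p] \<theta>[of p'] eq show "p = p'" by (intro inject[of "\<theta> p + x"]) auto
  qed
  define \<Theta> where "\<Theta> = range \<theta>"
  define M where "M t = distr \<mu> borel ((+) t)" for t
  \<comment> \<open>The points outside all the sets are assigned to the parameter with index \<open>{}\<close>.\<close>
  define ind where "ind x = (if \<exists>p. x \<in> Y p then THE p. x \<in> Y p else {})" for x
  define T where "T x = \<theta> (ind x)" for x
  have ind: "ind x = p" if "x \<in> Y p" for x p
    unfolding ind_def using that inject by (auto intro!: the_equality)
  have vimage: "T -` {\<theta> p} = Y p \<union> (if p = {} then - (\<Union>p. Y p) else {})" for p
  proof -
    have "T x = \<theta> p \<longleftrightarrow> x \<in> Y p \<or> p = {} \<and> x \<notin> (\<Union>p. Y p)" for x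
    proof (cases "x \<in> (\<Union>p. Y p)")
      case True
      then obtain p' where "x \<in> Y p'" by blast
      with inject[OF this] True show ?thesis
        unfolding T_def inj_eq[OF inj] ind[OF \<open>x \<in> Y p'\<close>] by blast
    next
      case False
      then have "ind x = {}" by (simp add: ind_def)
      with False show ?thesis unfolding T_def inj_eq[OF inj] by blast
    qed
    then show ?thesis by auto
  qed
  have borel: "T -` {\<theta> p} \<in> sets borel" for p
  proof -
    have "Y p \<in> sets borel" "- (\<Union>p. Y p) \<in> sets borel"
      using closed by (simp_all only: borel_closed borel_comp)
    then show ?thesis unfolding vimage by (simp only: sets.Un sets.empty_sets split: if_split) simp
  qed
  have measurable: "T \<in> borel \<rightarrow>\<^sub>M singleton_algebra \<Theta>"
    unfolding singleton_algebra_def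
  proof (rule measurable_measure_of)
    show "T -` A \<inter> space borel \<in> sets borel" if "A \<in> {{t} |t. t \<in> \<Theta>}" for A
      using that borel by (auto simp: \<Theta>_def)
  qed (auto simp: \<Theta>_def T_def)
  have shift: "emeasure (M t) X = emeasure \<mu> ((\<lambda>x. - t + x) ` X)" if "X \<in> sets borel" for t X
    unfolding M_def using sets that by (rule emeasure_left_shift)
  have "emeasure (M (\<theta> p)) (T -` {\<theta> p}) = 1" for p
  proof -
    let ?X = "T -` {\<theta> p}"
    have "K\<^sub>0 \<subseteq> (\<lambda>x. - \<theta> p + x) ` ?X"
    proof
      fix x assume "x \<in> K\<^sub>0"
      then have "\<theta> p + x \<in> ?X" using \<theta>[of p] unfolding vimage by blast
      then show "x \<in> (\<lambda>x. - \<theta> p + x) ` ?X" by (force simp: add.assoc[symmetric])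
    qed
    then have "1 \<le> emeasure \<mu> ((\<lambda>x. - \<theta> p + x) ` ?X)"
      using \<mu>K0 left_translate_borel[OF borel] sets by (metis emeasure_mono)
    with prob_space.emeasure_le_1[OF prob] show ?thesis
      unfolding shift[OF borel] by (metis antisym)
  qed
  moreover have "Haar_ambivalent (T -` {\<theta> p})" for p
  proof -
    have not_shy: "\<not> shy (T -` {\<theta> p'})" for p'
    proof (rule not_shy_if_absorbs_compact)
      fix K :: "'a set" assume "compact K"
      from absorbs[OF this] obtain h where "(+) h ` K \<subseteq> Y p'" ..
      then have "(+) h ` K \<subseteq> T -` {\<theta> p'}" unfolding vimage by (rule le_supI1)
      then show "\<exists>h. (+) h ` K \<subseteq> T -` {\<theta> p'}" ..
    qed
    have "\<theta> (- p) \<noteq> \<theta> p" unfolding inj_eq[OF inj] by (metis Compl_iff)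
    then have "T -` {\<theta> (- p)} \<subseteq> - (T -` {\<theta> p})" by auto
    with not_shy[of "- p"] have "\<not> prevalent (T -` {\<theta> p})"
      unfolding prevalent_def using shy_mono by blast
    with borel not_shy show ?thesis unfolding Haar_ambivalent_def by blast
  qed
  ultimately have "objective_consistent_estimate \<Theta> M T"
    unfolding objective_consistent_estimate_def using measurable by (auto simp: \<Theta>_def)
  moreover have "statistical_structure \<Theta> M"
    unfolding statistical_structure_def M_def
    using borel_probability_left_shift[OF assms(2)] by (auto simp: \<Theta>_def)
  moreover have "\<Theta> \<approx> (UNIV :: nat set set)"
    unfolding \<Theta>_def using inj by (rule inj_on_image_eqpoll_self)
  ultimately show ?thesis using shift by blast
qed

end
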